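(* Let $X$ be a locally compact and $\sigma$-compact metric space, let $\mu$ be a Radon measure on $X$ whose support coincides with $X$, and let $\mathcal{A}$ be a self-adjoint unital subalgebra of $C_b(X)$ separating points of $X$. Then $\operatorname{clos}_\tau(\mathcal{A})=L^\infty(X,\mu)$, where $\tau$ is the weak-$*$ topology of $L^\infty(X,\mu)$.
   Context: $C_b(X)$ is the C*-algebra of bounded continuous functions $X\to\mathbb{C}$. Since the support of $\mu$ is $X$ (i.e. $\mu(U)>0$ for every non-empty open $U\subseteq X$), $C_b(X)$ is naturally embedded into $L^\infty(X,\mu)$. The weak-$*$ topology $\tau$ on $L^\infty(X,\mu)$ is the one coming from the duality with $L^1(X,\mu)$: $a_j\to b$ iff $\int_X a_j f\,\mathrm{d}\mu\to\int_X b f\,\mathrm{d}\mu$ for every $f\in L^1(X,\mu)$. Self-adjoint means closed under complex conjugation; unital means containing the constant function $1$. The algebra $\mathcal{A}$ is not assumed to be closed or dense in the norm topology of $C_b(X)$. *)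

theory Defs
  imports "HOL-Analysis.Analysis"
begin

definition sigma_compact_space :: "'a topology \<Rightarrow> bool" where
  "sigma_compact_space X \<longleftrightarrow>
     (\<exists>K :: nat \<Rightarrow> 'a set. (\<forall>n. compactin X (K n)) \<and> (\<Union>n. K n) = topspace X)"

text \<open>Radon measures are positive Borel measures, finite on compact sets, outer regular on Borel
  sets and inner regular on open sets.\<close>

definition radon_measure :: "'a::t2_space measure \<Rightarrow> bool" where
  "radon_measure M \<longleftrightarrow>
     sets M = sets borel \<and>
     (\<forall>K. compact K \<longrightarrow> emeasure M K < \<infinity>) \<and>
     (\<forall>B \<in> sets borel. emeasure M B = (INF U \<in> {U. open U \<and> B \<subseteq> U}. emeasure M U)) \<and>
     (\<forall>U. open U \<longrightarrow> emeasure M U = (SUP K \<in> {K. compact K \<and> K \<subseteq> U}. emeasure M K))"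

text \<open>The set \<open>bcontfun\<close> at type \<open>'a \<Rightarrow> complex\<close> is $C_b(X)$.\<close>

definition unital_selfadjoint_subalgebra :: "('a::topological_space \<Rightarrow> complex) set \<Rightarrow> bool" where
  "unital_selfadjoint_subalgebra A \<longleftrightarrow>
     A \<subseteq> bcontfun \<and>
     (\<lambda>x. 1) \<in> A \<and>
     (\<forall>f \<in> A. \<forall>g \<in> A. (\<lambda>x. f x + g x) \<in> A) \<and>
     (\<forall>c. \<forall>f \<in> A. (\<lambda>x. c * f x) \<in> A) \<and>
     (\<forall>f \<in> A. \<forall>g \<in> A. (\<lambda>x. f x * g x) \<in> A) \<and>
     (\<forall>f \<in> A. (\<lambda>x. cnj (f x)) \<in> A)"

definition separates_points :: "('a \<Rightarrow> 'b) set \<Rightarrow> bool" where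
  "separates_points A \<longleftrightarrow> (\<forall>x y. x \<noteq> y \<longrightarrow> (\<exists>f \<in> A. f x \<noteq> f y))"

text \<open>Elements of $L^\infty$ are almost-everywhere equivalence classes of measurable functions.\<close>

definition ae_class :: "'a measure \<Rightarrow> ('a \<Rightarrow> complex) \<Rightarrow> ('a \<Rightarrow> complex) set" where
  "ae_class M f = {g \<in> borel_measurable M. AE x in M. g x = f x}"

definition L_infty :: "'a measure \<Rightarrow> ('a \<Rightarrow> complex) set set" where
  "L_infty M =
     ae_class M ` {f \<in> borel_measurable M. \<exists>C::real. AE x in M. norm (f x) \<le> C}"

text \<open>The choice of a representative is immaterial: see \<open>L_pairing_ae_class\<close>.\<close>

definition L_pairing :: "'a measure \<Rightarrow> ('a \<Rightarrow> complex) set \<Rightarrow> ('a \<Rightarrow> complex) \<Rightarrow> complex" where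
  "L_pairing M a f = (\<integral>x. (SOME g. g \<in> a) x * f x \<partial>M)"

definition weak_star_topology :: "'a measure \<Rightarrow> ('a \<Rightarrow> complex) set topology" where
  "weak_star_topology M = topology_generated_by
     {{a \<in> L_infty M. L_pairing M a f \<in> U} | f U. integrable M f \<and> open U}"

lemma L_pairing_ae_class:
  assumes "g \<in> borel_measurable M" "f \<in> borel_measurable M"
  shows "L_pairing M (ae_class M g) f = (\<integral>x. g x * f x \<partial>M)"
proof -
  define h where "h = (SOME h. h \<in> ae_class M g)"
  have "g \<in> ae_class M g"
    using assms by (simp add: ae_class_def)
  then have "h \<in> ae_class M g"
    unfolding h_def by (metis someI)
  then have h: "h \<in> borel_measurable M" "AE x in M. h x = g x"
    by (auto simp: ae_class_def)
  have "(\<integral>x. h x * f x \<partial>M) = (\<integral>x. g x * f x \<partial>M)"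
    using h assms by (intro integral_cong_AE) auto
  then show ?thesis
    by (simp add: L_pairing_def h_def)
qed

lemma topspace_weak_star [simp]: "topspace (weak_star_topology M) = L_infty M"
proof -
  have "L_infty M \<in> {{a \<in> L_infty M. L_pairing M a f \<in> U} | f U. integrable M f \<and> open U}"
    by (rule CollectI, rule exI[of _ "\<lambda>x. 0"], rule exI[of _ UNIV]) auto
  then show ?thesis
    unfolding weak_star_topology_def topology_generated_by_topspace by blast
qed

lemma limitin_weak_star:
  assumes a: "\<And>j. a j \<in> L_infty M" and b: "b \<in> L_infty M"
  shows "limitin (weak_star_topology M) a b F \<longleftrightarrow>
    (\<forall>f. integrable M f \<longrightarrow> ((\<lambda>j. L_pairing M (a j) f) \<longlongrightarrow> L_pairing M b f) F)"
    (is "?L \<longleftrightarrow> ?R")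
proof
  assume L: ?L
  show ?R
  proof (intro allI impI topological_tendstoI)
    fix f U assume f: "integrable M f" and U: "open U" "L_pairing M b f \<in> U"
    let ?V = "{a \<in> L_infty M. L_pairing M a f \<in> U}"
    have "openin (weak_star_topology M) ?V"
      unfolding weak_star_topology_def
      by (rule topology_generated_by_Basis) (use f U in blast)
    moreover have "b \<in> ?V" using b U by simp
    ultimately have "eventually (\<lambda>j. a j \<in> ?V) F"
      using L unfolding limitin_def by blast
    then show "eventually (\<lambda>j. L_pairing M (a j) f \<in> U) F"
      by (rule eventually_mono) simp
  qed
next
  assume R: ?R
  have "eventually (\<lambda>j. a j \<in> V) F"
    if "generate_topology_on
          {{a \<in> L_infty M. L_pairing M a f \<in> U} | f U. integrable M f \<and> open U} V"
       "b \<in> V" for V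
    using that
  proof induction
    case Empty
    then show ?case by simp
  next
    case (Int V W)
    then show ?case by (auto intro: eventually_conj)
  next
    case (UN K)
    then obtain k where "k \<in> K" "b \<in> k" by blast
    with UN have "eventually (\<lambda>j. a j \<in> k) F" by blast
    then show ?case by (rule eventually_mono) (use \<open>k \<in> K\<close> in blast)
  next
    case (Basis V)
    then obtain f U where V: "V = {a \<in> L_infty M. L_pairing M a f \<in> U}"
      and f: "integrable M f" and U: "open U" by blast
    have "eventually (\<lambda>j. L_pairing M (a j) f \<in> U) F"
      using R f U Basis.prems V by (auto dest: topological_tendstoD)
    then show ?case using a V by simp
  qed
  then show ?L
    using b unfolding limitin_def topspace_weak_star
    by (auto simp: weak_star_topology_def openin_topology_generated_by_iff)
qed

end

theory Submission
  imports Defs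
begin

text \<open>A basic weak-* neighbourhood of the class of a bounded \<open>g\<close> contains the class of every
  bounded \<open>g'\<close> for which \<open>\<integral>F * norm (g' - g) \<partial>\<mu>\<close> is small, where \<open>F\<close> is a single nonnegative
  integrable function. Hence it suffices that \<open>A\<close> is dense in \<open>L\<^sup>1\<close> of the finite measure
  \<open>density \<mu> F\<close>. There, a continuous \<open>h\<close> with values in the unit interval is approximated by
  Stone-Weierstrass on a compact set of almost full measure, and composing the approximant with a
  polynomial close to the truncation to the unit interval keeps it bounded off the compact set.
  Closed sets are decreasing limits of such \<open>h\<close>, and a Dynkin argument reaches all Borel sets.\<close>

section \<open>Closure in the mean and its stability properties\<close>

text \<open>The closure is taken for the L1 seminorm on functions rather than on classes.
  Integrability of \<open>a\<close> is demanded explicitly because the integral of a non-integrable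
  function defaults to 0, which would make the inequality meaningless.\<close>

definition L1_closure :: "'a measure \<Rightarrow> ('a \<Rightarrow> complex) set \<Rightarrow> ('a \<Rightarrow> complex) set" where
  "L1_closure M A = {f. integrable M f \<and> (\<forall>e>0. \<exists>a\<in>A. integrable M a \<and> (\<integral>x. norm (a x - f x) \<partial>M) < e)}"

lemma L1_closureI_approx:
  assumes "integrable M f"
    and "\<And>e. e > 0 \<Longrightarrow> \<exists>g \<in> L1_closure M A. (\<integral>x. norm (g x - f x) \<partial>M) < e"
  shows "f \<in> L1_closure M A"
  unfolding L1_closure_def
proof (intro CollectI conjI allI impI)
  fix e :: real assume "e > 0"
  then obtain g where g: "g \<in> L1_closure M A" "(\<integral>x. norm (g x - f x) \<partial>M) < e/2"
    using assms(2)[of "e/2"] by auto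
  then have ig: "integrable M g" by (simp add: L1_closure_def)
  obtain a where a: "a \<in> A" "integrable M a" "(\<integral>x. norm (a x - g x) \<partial>M) < e/2"
    using g(1) \<open>e > 0\<close> unfolding L1_closure_def by (auto dest!: spec[of _ "e/2"])
  have "(\<integral>x. norm (a x - f x) \<partial>M) \<le> (\<integral>x. norm (a x - g x) + norm (g x - f x) \<partial>M)"
    using a ig assms(1) by (intro integral_mono) (auto intro: norm_triangle_le_diff norm_diff_triangle_le)
  also have "\<dots> = (\<integral>x. norm (a x - g x) \<partial>M) + (\<integral>x. norm (g x - f x) \<partial>M)"
    using a ig assms(1) by (intro Bochner_Integration.integral_add) auto
  finally show "\<exists>a\<in>A. integrable M a \<and> (\<integral>x. norm (a x - f x) \<partial>M) < e"
    using a g by (intro bexI[of _ a]) auto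
qed fact

text \<open>Dominated convergence upgrades pointwise convergence to convergence in the mean, under
  which the closure is stable. Every later limit passage goes through this fact.\<close>

lemma L1_closure_dominated:
  assumes s: "\<And>i. s i \<in> L1_closure M A" and f: "f \<in> borel_measurable M"
    and lim: "\<And>x. x \<in> space M \<Longrightarrow> (\<lambda>i. s i x) \<longlonglongrightarrow> f x"
    and w: "integrable M w" "\<And>i x. x \<in> space M \<Longrightarrow> norm (s i x) \<le> w x"
  shows "f \<in> L1_closure M A"
proof -
  have si: "integrable M (s i)" for i using s by (simp add: L1_closure_def)
  have fw: "norm (f x) \<le> w x" if "x \<in> space M" for x
    using lim[OF that] w(2)[OF that] by (intro Lim_bounded[OF tendsto_norm]) auto
  have fi: "integrable M f"
    using w(1) f by (rule Bochner_Integration.integrable_bound) (use fw in \<open>auto intro!: AE_I2 order.trans[OF _ abs_ge_self]\<close>)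
  have "(\<lambda>i. \<integral>x. norm (s i x - f x) \<partial>M) \<longlonglongrightarrow> (\<integral>x. 0 \<partial>M)"
  \<comment> \<open>The bound \<open>w\<close> passes to the limit \<open>f\<close>, so the
    differences are dominated by \<open>2 * w\<close>.\<close>
  proof (rule integral_dominated_convergence[where w = "\<lambda>x. 2 * w x"])
    show "AE x in M. (\<lambda>i. norm (s i x - f x)) \<longlonglongrightarrow> 0"
      using lim by (intro AE_I2 tendsto_norm_zero) (auto simp: LIM_zero)
    show "AE x in M. norm (norm (s i x - f x)) \<le> 2 * w x" for i
    proof (rule AE_I2)
      fix x assume "x \<in> space M"
      then show "norm (norm (s i x - f x)) \<le> 2 * w x"
        using w(2)[of x i] fw[of x] norm_triangle_ineq4[of "s i x" "f x"] by simp
    qed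
  qed (use w fi si in auto)
  then have "\<exists>i. (\<integral>x. norm (s i x - f x) \<partial>M) < e" if "e > 0" for e
    using order_tendstoD(2)[of _ 0 sequentially e] that by (fastforce dest: eventually_happens)
  then show ?thesis
    using s fi by (intro L1_closureI_approx) auto
qed

lemma
  assumes "unital_selfadjoint_subalgebra A"
  shows subalgebra_bcontfun: "f \<in> A \<Longrightarrow> f \<in> bcontfun"
    and subalgebra_one: "(\<lambda>x. 1) \<in> A"
    and subalgebra_add: "f \<in> A \<Longrightarrow> g \<in> A \<Longrightarrow> (\<lambda>x. f x + g x) \<in> A"
    and subalgebra_scale: "f \<in> A \<Longrightarrow> (\<lambda>x. c * f x) \<in> A"
    and subalgebra_mult: "f \<in> A \<Longrightarrow> g \<in> A \<Longrightarrow> (\<lambda>x. f x * g x) \<in> A"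
    and subalgebra_cnj: "f \<in> A \<Longrightarrow> (\<lambda>x. cnj (f x)) \<in> A"
  using assms unfolding unital_selfadjoint_subalgebra_def by auto

lemma L1_closure_add:
  assumes A: "unital_selfadjoint_subalgebra A"
    and "f \<in> L1_closure M A" "g \<in> L1_closure M A"
  shows "(\<lambda>x. f x + g x) \<in> L1_closure M A"
  unfolding L1_closure_def
proof (intro CollectI conjI allI impI)
  have i: "integrable M f" "integrable M g" using assms by (auto simp: L1_closure_def)
  then show "integrable M (\<lambda>x. f x + g x)" by simp
  fix e :: real assume "e > 0"
  then obtain a b where a: "a \<in> A" "integrable M a" "(\<integral>x. norm (a x - f x) \<partial>M) < e/2"
    and b: "b \<in> A" "integrable M b" "(\<integral>x. norm (b x - g x) \<partial>M) < e/2"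
    using assms(2,3) unfolding L1_closure_def by (fastforce dest!: spec[of _ "e/2"])
  have "(\<integral>x. norm (a x + b x - (f x + g x)) \<partial>M) \<le> (\<integral>x. norm (a x - f x) + norm (b x - g x) \<partial>M)"
    using a b i by (intro integral_mono) (auto intro: norm_diff_triangle_ineq)
  also have "\<dots> = (\<integral>x. norm (a x - f x) \<partial>M) + (\<integral>x. norm (b x - g x) \<partial>M)"
    using a b i by (intro Bochner_Integration.integral_add) auto
  finally show "\<exists>c\<in>A. integrable M c \<and> (\<integral>x. norm (c x - (f x + g x)) \<partial>M) < e"
    using a b by (intro bexI[of _ "\<lambda>x. a x + b x"] subalgebra_add[OF A]) auto
qed

lemma L1_closure_scale:
  assumes A: "unital_selfadjoint_subalgebra A" and f: "f \<in> L1_closure M A"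
  shows "(\<lambda>x. c * f x) \<in> L1_closure M A"
  unfolding L1_closure_def
proof (intro CollectI conjI allI impI)
  have i: "integrable M f" using f by (auto simp: L1_closure_def)
  then show "integrable M (\<lambda>x. c * f x)" by simp
  fix e :: real assume "e > 0"
  \<comment> \<open>The summand 1 keeps the denominator positive when \<open>c = 0\<close>.\<close>
  define d where "d = e / (norm c + 1)"
  have "d > 0" using \<open>e > 0\<close> unfolding d_def by (intro divide_pos_pos) (auto intro: add_nonneg_pos)
  then obtain a where a: "a \<in> A" "integrable M a" "(\<integral>x. norm (a x - f x) \<partial>M) < d"
    using f unfolding L1_closure_def by blast
  have "(\<integral>x. norm (c * a x - c * f x) \<partial>M) = norm c * (\<integral>x. norm (a x - f x) \<partial>M)"
    by (simp add: right_diff_distrib[symmetric] norm_mult)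
  also have "\<dots> \<le> norm c * d"
    using a by (intro mult_left_mono) auto
  also have "\<dots> < (norm c + 1) * d" using \<open>d > 0\<close> by simp
  also have "\<dots> = e"
    using norm_ge_zero[of c] unfolding d_def by (simp add: add_nonneg_eq_0_iff)
  finally show "\<exists>b\<in>A. integrable M b \<and> (\<integral>x. norm (b x - c * f x) \<partial>M) < e"
    using a by (intro bexI[of _ "\<lambda>x. c * a x"] subalgebra_scale[OF A]) auto
qed

section \<open>Uniform approximation on compact sets with a global bound\<close>

text \<open>Polynomials are generated from linear maps and constants by sums and products, and each
  of these operations stays in \<open>A\<close>; constants come from the unit. Since
  \<open>A\<close> need not be norm closed, polynomials stand in for general continuous functions in
  later compositions.\<close>

lemma subalgebra_polynomial:
  assumes A: "unital_selfadjoint_subalgebra A"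
    and p: "real_polynomial_function (p :: real \<Rightarrow> real)"
    and r: "(\<lambda>x. complex_of_real (r x)) \<in> A"
  shows "(\<lambda>x. complex_of_real (p (r x))) \<in> A"
  using p
proof induction
  case (linear f)
  then obtain c where "f = (\<lambda>x. x * c)" by (auto simp: real_bounded_linear)
  then show ?case using subalgebra_scale[OF A r, of "of_real c"] by (simp add: mult.commute)
next
  case (const c)
  show ?case using subalgebra_scale[OF A subalgebra_one[OF A], of "of_real c"] by simp
next
  case (add f g)
  then show ?case using subalgebra_add[OF A] by fastforce
next
  case (mult f g)
  then show ?case using subalgebra_mult[OF A] by fastforce
qed

text \<open>Approximation on \<open>K\<close> gives no control elsewhere. The approximant
  \<open>q\<close> is nevertheless bounded on the whole space, so a polynomial can imitate
  truncation to the unit interval on a compact interval containing all its values. Truncation does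
  not spoil the approximation on \<open>K\<close>, because \<open>h\<close> already takes values in
  the unit interval.\<close>

lemma bounded_Stone_Weierstrass:
  fixes A :: "('a::metric_space \<Rightarrow> complex) set"
  assumes A: "unital_selfadjoint_subalgebra A" and sep: "separates_points A"
    and K: "compact K" and h: "continuous_on UNIV h" "\<And>x. h x \<in> {0..1::real}" and e: "e > 0"
  obtains r where "(\<lambda>x. complex_of_real (r x)) \<in> A"
    "\<And>x. x \<in> K \<Longrightarrow> \<bar>r x - h x\<bar> < e" "\<And>x. \<bar>r x\<bar> \<le> 1 + e"
proof -
  \<comment> \<open>Stone-Weierstrass is applied to the real-valued members of \<open>A\<close>.
    Self-adjointness puts real and imaginary parts of members of \<open>A\<close> into
    \<open>R\<close>, so \<open>R\<close> still separates points.\<close>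
  define R where "R = {r :: 'a \<Rightarrow> real. (\<lambda>x. complex_of_real (r x)) \<in> A}"
  have re: "(\<lambda>x. Re (f x)) \<in> R" if "f \<in> A" for f
  proof -
    have "(\<lambda>x. (1/2) * (f x + cnj (f x))) \<in> A"
      by (intro subalgebra_scale[OF A] subalgebra_add[OF A] subalgebra_cnj[OF A] that)
    then show ?thesis by (simp add: R_def complex_add_cnj)
  qed
  have im: "(\<lambda>x. Im (f x)) \<in> R" if "f \<in> A" for f
    using re[OF subalgebra_scale[OF A that, of "-\<i>"]] by simp
  have cont: "continuous_on UNIV r" "bounded (range r)" if "r \<in> R" for r
  proof -
    have "(\<lambda>x. complex_of_real (r x)) \<in> bcontfun"
      using subalgebra_bcontfun[OF A] that by (auto simp: R_def)
    then have *: "continuous_on UNIV (\<lambda>x. complex_of_real (r x))"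
      "bounded (range (\<lambda>x. complex_of_real (r x)))"
      by (auto simp: bcontfun_def)
    show "continuous_on UNIV r" using continuous_on_Re[OF *(1)] by simp
    show "bounded (range r)" using *(2) by (simp add: bounded_iff)
  qed
  interpret function_ring_on R K
  proof
    show "continuous_on K f" if "f \<in> R" for f
      using cont(1)[OF that] by (rule continuous_on_subset) simp
    show "(\<lambda>x. f x + g x) \<in> R" if "f \<in> R" "g \<in> R" for f g
      using subalgebra_add[OF A] that by (fastforce simp: R_def)
    show "(\<lambda>x. f x * g x) \<in> R" if "f \<in> R" "g \<in> R" for f g
      using subalgebra_mult[OF A] that by (fastforce simp: R_def)
    show "(\<lambda>x. c) \<in> R" for c
      using subalgebra_scale[OF A subalgebra_one[OF A], of "of_real c"] by (simp add: R_def)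
    show "\<exists>f\<in>R. f x \<noteq> f y" if "x \<noteq> y" for x y
    proof -
      obtain f where f: "f \<in> A" "f x \<noteq> f y"
        using sep \<open>x \<noteq> y\<close> unfolding separates_points_def by blast
      then have "Re (f x) \<noteq> Re (f y) \<or> Im (f x) \<noteq> Im (f y)" by (simp add: complex_eq_iff)
      then show ?thesis by (elim disjE bexI[OF _ re[OF f(1)]] bexI[OF _ im[OF f(1)]])
    qed
  qed fact
  have "continuous_on K h" using h(1) by (rule continuous_on_subset) simp
  then obtain q where q: "q \<in> R" "\<And>x. x \<in> K \<Longrightarrow> \<bar>h x - q x\<bar> < e/2"
    using Stone_Weierstrass_basic[of h "e/2"] e by auto
  \<comment> \<open>The bound must hold on the whole space, since \<open>p\<close> has to be
    accurate at \<open>q x\<close> also for \<open>x\<close> outside \<open>K\<close>.\<close>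
  obtain B where B: "\<And>x. \<bar>q x\<bar> \<le> B"
    using cont(2)[OF q(1)] by (auto simp: bounded_iff)
  define \<phi> :: "real \<Rightarrow> real" where "\<phi> = (\<lambda>t. max 0 (min 1 t))"
  have "continuous_on {-B..B} \<phi>" unfolding \<phi>_def by (intro continuous_intros)
  then obtain p where p: "real_polynomial_function p"
      "\<And>t. t \<in> {-B..B} \<Longrightarrow> \<bar>\<phi> t - p t\<bar> < e/2"
    using Stone_Weierstrass_real_polynomial_function[of "{-B..B}" \<phi> "e/2"] e by auto
  have pq: "\<bar>\<phi> (q x) - p (q x)\<bar> < e/2" for x
    using p(2)[of "q x"] B[of x] by (auto simp: abs_le_iff)
  show thesis
  proof (rule that[of "\<lambda>x. p (q x)"])
    show "(\<lambda>x. complex_of_real (p (q x))) \<in> A"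
      using subalgebra_polynomial[OF A p(1)] q(1) by (simp add: R_def)
    show "\<bar>p (q x) - h x\<bar> < e" if "x \<in> K" for x
    proof -
      \<comment> \<open>\<open>\<phi>\<close> is 1-Lipschitz and fixes \<open>h x\<close>.\<close>
      have "\<bar>\<phi> (q x) - h x\<bar> \<le> \<bar>q x - h x\<bar>"
        using h(2)[of x] by (auto simp: \<phi>_def max_def min_def abs_if)
      then show ?thesis using pq[of x] q(2)[OF that] by linarith
    qed
    show "\<bar>p (q x)\<bar> \<le> 1 + e" for x
      using pq[of x] e by (auto simp: \<phi>_def max_def min_def abs_if split: if_splits)
  qed
qed

section \<open>Continuous functions in the closure\<close>

lemma compact_almost_full_measure:
  fixes M :: "'a::metric_space measure"
  assumes "finite_measure M" and sets: "sets M = sets borel"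
    and X: "sigma_compact_space (euclidean :: 'a topology)" and e: "e > 0"
  obtains K where "compact K" "measure M (- K) < e"
proof -
  interpret finite_measure M by fact
  have sp: "space M = UNIV" using sets_eq_imp_space_eq[OF sets] by simp
  obtain K :: "nat \<Rightarrow> 'a set" where K: "\<And>n. compact (K n)" "(\<Union>n. K n) = UNIV"
    using X unfolding sigma_compact_space_def by auto
  \<comment> \<open>The given compact sets need not increase; finite unions make them an increasing
    exhaustion, so continuity of the measure from below applies.\<close>
  define L where "L n = (\<Union>i\<le>n. K i)" for n
  have L: "compact (L n)" for n unfolding L_def using K by (intro compact_UN) auto
  then have Ls: "L n \<in> sets M" for n using sets by (auto intro: borel_closed compact_imp_closed)
  have "incseq L" unfolding L_def by (intro monoI UN_mono) auto
  moreover have "(\<Union>n. L n) = UNIV" using K(2) unfolding L_def by auto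
  ultimately have "(\<lambda>n. measure M (L n)) \<longlonglongrightarrow> measure M (space M)"
    using finite_Lim_measure_incseq[of L] Ls sp by auto
  then have "eventually (\<lambda>n. measure M (L n) > measure M (space M) - e) sequentially"
    using e by (intro order_tendstoD) auto
  then obtain n where "measure M (L n) > measure M (space M) - e"
    by (auto dest: eventually_happens)
  moreover have "measure M (- L n) = measure M (space M) - measure M (L n)"
    using finite_measure_compl[OF Ls, of n] sp by (simp add: Compl_eq_Diff_UNIV)
  ultimately show thesis using that[OF L, of n] by simp
qed

lemma subalgebra_measurable:
  fixes M :: "'a::metric_space measure"
  assumes A: "unital_selfadjoint_subalgebra A" and sets: "sets M = sets borel" and a: "a \<in> A"
  obtains C where "a \<in> borel_measurable M" "\<And>x. norm (a x) \<le> C"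
proof -
  have "continuous_on UNIV a" "bounded (range a)"
    using subalgebra_bcontfun[OF A a] by (auto simp: bcontfun_def)
  then show thesis
    using that borel_measurable_continuous_onI[of a] measurable_cong_sets[OF sets refl]
    by (auto simp: bounded_iff)
qed

text \<open>The error is split over a compact \<open>K\<close> of almost full measure, where it is
  uniformly small, and over the complement of \<open>K\<close>, where it is bounded by a fixed
  constant but the measure is small.\<close>

lemma L1_closure_continuous:
  fixes M :: "'a::metric_space measure"
  assumes "finite_measure M" and sets: "sets M = sets borel"
    and X: "sigma_compact_space (euclidean :: 'a topology)"
    and A: "unital_selfadjoint_subalgebra A" and sep: "separates_points A"
    and h: "continuous_on UNIV h" "\<And>x. h x \<in> {0..1::real}"
  shows "(\<lambda>x. complex_of_real (h x)) \<in> L1_closure M A"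
  unfolding L1_closure_def
proof (intro CollectI conjI allI impI)
  interpret finite_measure M by fact
  have [measurable]: "h \<in> borel_measurable M"
    using borel_measurable_continuous_onI[OF h(1)] measurable_cong_sets[OF sets refl] by auto
  show ih: "integrable M (\<lambda>x. complex_of_real (h x))"
    using h(2) by (intro integrable_const_bound[of _ 1]) auto
  fix e :: real assume e: "e > 0"
  let ?m = "measure M (space M)"
  \<comment> \<open>The second term makes \<open>d * ?m\<close> at most \<open>e/2\<close>; the
    summand 1 avoids division by zero when the measure vanishes.\<close>
  define d where "d = min 1 (e / (2 * (?m + 1)))"
  have m: "?m \<ge> 0" by simp
  then have d: "d > 0" "d \<le> 1" using e by (auto simp: d_def intro!: divide_pos_pos add_nonneg_pos)
  have "d * ?m \<le> e / (2 * (?m + 1)) * ?m" unfolding d_def by (intro mult_right_mono) auto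
  also have "\<dots> = e/2 * (?m / (?m + 1))" by simp
  also have "\<dots> \<le> e/2 * 1"
  proof (rule mult_left_mono)
    have "?m + 1 > 0" using m by linarith
    then show "?m / (?m + 1) \<le> 1" by (simp add: divide_le_eq_1_pos)
  qed (use e in simp)
  finally have dm: "d * ?m \<le> e/2" by simp
  \<comment> \<open>The error off \<open>K\<close> will be bounded by \<open>d + 3\<close>, and the
    part 3 then contributes less than \<open>3 * (e/6) = e/2\<close>.\<close>
  obtain K where K: "compact K" "measure M (- K) < e/6"
    using compact_almost_full_measure[OF assms(1) sets X, of "e/6"] e by auto
  obtain r where r: "(\<lambda>x. complex_of_real (r x)) \<in> A"
    "\<And>x. x \<in> K \<Longrightarrow> \<bar>r x - h x\<bar> < d" "\<And>x. \<bar>r x\<bar> \<le> 1 + d"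
    using bounded_Stone_Weierstrass[OF A sep K(1) h d(1)] by blast
  have [measurable]: "- K \<in> sets M"
    unfolding sets using K(1) by (intro borel_open open_Compl compact_imp_closed)
  obtain C where rm: "(\<lambda>x. complex_of_real (r x)) \<in> borel_measurable M"
      "\<And>x. norm (complex_of_real (r x)) \<le> C"
    using subalgebra_measurable[OF A sets r(1)] by blast
  then have ir: "integrable M (\<lambda>x. complex_of_real (r x))"
    by (intro integrable_const_bound[of _ C]) auto
  have iK: "integrable M (indicator (- K) :: 'a \<Rightarrow> real)"
    by (rule integrable_const_bound[where B = 1]) (auto simp: indicator_def)
  have "norm (complex_of_real (r x) - complex_of_real (h x)) \<le> d + 3 * indicator (- K) x" for x
  proof (cases "x \<in> K")
    case True
    then show ?thesis using r(2)[of x] by (simp flip: of_real_diff)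
  next
    case False
    then show ?thesis using r(3)[of x] h(2)[of x] d by (simp flip: of_real_diff) arith
  qed
  then have "(\<integral>x. norm (complex_of_real (r x) - complex_of_real (h x)) \<partial>M)
      \<le> (\<integral>x. d + 3 * indicator (- K) x \<partial>M)"
    using ir ih iK by (intro integral_mono) auto
  also have "\<dots> = d * ?m + 3 * measure M (- K)"
    using iK by (subst Bochner_Integration.integral_add) auto
  also have "\<dots> < e" using dm K(2) by simp
  finally show "\<exists>a\<in>A. integrable M a \<and> (\<integral>x. norm (a x - complex_of_real (h x)) \<partial>M) < e"
    using ir r(1) by blast
qed

section \<open>From continuous functions to all integrable functions\<close>

lemma L1_closure_closed_set:
  fixes M :: "'a::metric_space measure"
  assumes M: "finite_measure M" and sets: "sets M = sets borel"
    and X: "sigma_compact_space (euclidean :: 'a topology)"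
    and A: "unital_selfadjoint_subalgebra A" and sep: "separates_points A"
    and C: "closed C"
  shows "(indicator C :: 'a \<Rightarrow> complex) \<in> L1_closure M A"
\<comment> \<open>The distance to the empty set is 0 by convention, so the functions
  \<open>h n\<close> below would be constantly 1 and miss the indicator of the empty set.\<close>
proof (cases "C = {}")
  case True
  have "(\<lambda>x. complex_of_real 0) \<in> L1_closure M A"
    by (rule L1_closure_continuous[OF M sets X A sep]) auto
  then show ?thesis using True by (simp add: indicator_def[abs_def])
next
  case False
  interpret finite_measure M by fact
  define h where "h n x = max 0 (1 - real n * infdist x C)" for n x
  have h: "h n x \<in> {0..1}" for n x unfolding h_def by (auto simp: infdist_nonneg)
  show ?thesis
  proof (rule L1_closure_dominated[where s = "\<lambda>n x. complex_of_real (h n x)" and w = "\<lambda>x. 1"])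
    show "(\<lambda>x. complex_of_real (h n x)) \<in> L1_closure M A" for n
      by (rule L1_closure_continuous[OF M sets X A sep _ h])
        (unfold h_def, intro continuous_intros)
    show "(indicator C :: 'a \<Rightarrow> complex) \<in> borel_measurable M"
      using C sets by (intro borel_measurable_indicator) auto
    show "(\<lambda>n. complex_of_real (h n x)) \<longlonglongrightarrow> indicator C x" for x
    proof (cases "x \<in> C")
      case True
      then show ?thesis by (simp add: h_def)
    next
      case False
      then have pos: "infdist x C > 0"
        using in_closed_iff_infdist_zero[OF C \<open>C \<noteq> {}\<close>, of x] infdist_nonneg[of x C] by linarith
      \<comment> \<open>Off \<open>C\<close> the distance is positive, so the Archimedean property
        makes \<open>h n x\<close> exactly 0 from some index on.\<close>
      obtain N where N: "1 < real N * infdist x C" using ex_less_of_nat_mult[OF pos, of 1] by auto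
      have "h n x = 0" if "n \<ge> N" for n
      proof -
        have "real N * infdist x C \<le> real n * infdist x C"
          using that pos by (intro mult_right_mono) auto
        then show ?thesis using N by (simp add: h_def)
      qed
      then show ?thesis using False
        by (intro tendsto_eventually eventually_sequentiallyI[of N]) auto
    qed
    show "norm (complex_of_real (h n x)) \<le> 1" for n x using h[of n x] by simp
  qed simp
qed

text \<open>The closed sets form an intersection-stable generator of the Borel sets, so only
  complements and countable disjoint unions remain. Linearity handles complements and finite
  disjoint unions; dominated convergence with the constant 1, integrable as \<open>M\<close> is
  finite, handles countable ones.\<close>

lemma L1_closure_borel_set:
  fixes M :: "'a::metric_space measure"
  assumes M: "finite_measure M" and sets: "sets M = sets borel"
    and X: "sigma_compact_space (euclidean :: 'a topology)"
    and A: "unital_selfadjoint_subalgebra A" and sep: "separates_points A"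
    and B: "B \<in> sets M"
  shows "(indicator B :: 'a \<Rightarrow> complex) \<in> L1_closure M A"
proof -
  interpret finite_measure M by fact
  have borel: "sigma_sets UNIV (Collect closed) = sets M"
    unfolding sets by (simp add: borel_eq_closed)
  have "Int_stable (Collect closed :: 'a set set)" by (auto simp: Int_stable_def)
  moreover have "Collect closed \<subseteq> Pow (UNIV :: 'a set)" by simp
  moreover have "B \<in> sigma_sets UNIV (Collect closed)" using B borel by simp
  ultimately show ?thesis
  proof (induction rule: sigma_sets_induct_disjoint)
    case (basic C)
    then show ?case using L1_closure_closed_set[OF M sets X A sep] by simp
  next
    case empty
    show ?case using L1_closure_closed_set[OF M sets X A sep] by blast
  next
    case (compl C)
    \<comment> \<open>The whole space is closed, so its indicator is already in the closure.\<close>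
    have "(\<lambda>x. indicator UNIV x + (-1) * indicator C x :: complex) \<in> L1_closure M A"
      by (intro L1_closure_add[OF A] L1_closure_scale[OF A] compl
          L1_closure_closed_set[OF M sets X A sep]) simp
    moreover have "(\<lambda>x. indicator UNIV x + (-1) * indicator C x :: complex) = indicator (UNIV - C)"
      by (auto simp: indicator_def)
    ultimately show ?case by simp
  next
    case (union D)
    have fin: "(indicator (\<Union>i<n. D i) :: 'a \<Rightarrow> complex) \<in> L1_closure M A" for n :: nat
    proof (induction n)
      case 0
      show ?case using L1_closure_closed_set[OF M sets X A sep, of "{}"]
        by (simp only: lessThan_0 UN_empty closed_empty)
    next
      case (Suc n)
      have "D n \<inter> D i = {}" if "i < n" for i
        using disjoint_family_onD[OF union.hyps(1)] that by simp
      \<comment> \<open>Disjointness turns the indicator of the union into a sum of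
        indicators.\<close>
      then have "D n \<inter> (\<Union>i<n. D i) = {}" by blast
      then have "(indicator (\<Union>i<Suc n. D i) :: 'a \<Rightarrow> complex)
          = (\<lambda>x. indicator (D n) x + indicator (\<Union>i<n. D i) x)"
        by (auto simp: lessThan_Suc indicator_def fun_eq_iff)
      then show ?case using L1_closure_add[OF A union.IH[of n] Suc] by simp
    qed
    have D: "(\<Union>i. D i) \<in> sets M" using union.hyps(2) borel by auto
    show ?case
    proof (rule L1_closure_dominated[OF fin, where w = "\<lambda>x. 1"])
      show "(indicator (\<Union>i. D i) :: 'a \<Rightarrow> complex) \<in> borel_measurable M"
        using D by (rule borel_measurable_indicator)
      show "(\<lambda>n. indicator (\<Union>i<n. D i) x) \<longlonglongrightarrow> (indicator (\<Union>i. D i) x :: complex)" for x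
        by (rule LIMSEQ_indicator_UN)
    qed (auto simp: indicator_def)
  qed
qed

text \<open>Induction over integrable functions: multiples of indicators, sums, and pointwise limits
  of sequences dominated by twice the norm of the limit.\<close>

theorem L1_closure_eq_integrable:
  fixes M :: "'a::metric_space measure"
  assumes M: "finite_measure M" and sets: "sets M = sets borel"
    and X: "sigma_compact_space (euclidean :: 'a topology)"
    and A: "unital_selfadjoint_subalgebra A" and sep: "separates_points A"
  shows "L1_closure M A = {f. integrable M f}"
proof (intro equalityI subsetI)
  fix f :: "'a \<Rightarrow> complex" assume "f \<in> {f. integrable M f}"
  then have "integrable M f" by simp
  then show "f \<in> L1_closure M A"
  proof induction
    case (base B c)
    then show ?case
      using L1_closure_scale[OF A L1_closure_borel_set[OF M sets X A sep], of B c]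
      by (simp add: scaleR_conv_of_real mult.commute of_real_indicator)
  next
    case (add f g)
    then show ?case using L1_closure_add[OF A] by blast
  next
    case (lim f s)
    have "s i \<in> L1_closure M A" for i using lim by blast
    then show ?case
      by (rule L1_closure_dominated[where w = "\<lambda>x. 2 * norm (f x)"]) (use lim in auto)
  qed
qed (simp add: L1_closure_def)

section \<open>Weak-* neighbourhoods controlled by one integrable weight\<close>

text \<open>This is the Hoelder pairing of L1 with bounded functions. The general value type serves
  both real weights and complex test functions.\<close>

lemma integrable_mult_AE_bounded:
  fixes F :: "'a \<Rightarrow> 'b::{banach, second_countable_topology, real_normed_algebra}"
  assumes F: "integrable M F" and g: "g \<in> borel_measurable M" "AE x in M. norm (g x) \<le> C"
  shows "integrable M (\<lambda>x. F x * g x)"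
proof (rule Bochner_Integration.integrable_bound[where f = "\<lambda>x. C * norm (F x)"])
  show "AE x in M. norm (F x * g x) \<le> norm (C * norm (F x))"
    using g(2)
  proof eventually_elim
    case (elim x)
    have "norm (F x * g x) \<le> norm (F x) * norm (g x)" by (rule norm_mult_ineq)
    also have "\<dots> \<le> norm (F x) * C" using elim by (intro mult_left_mono) auto
    finally show ?case by (simp add: mult.commute)
  qed
qed (use F g in auto)

lemma integrable_weighted_diff:
  fixes g g' :: "'a \<Rightarrow> complex" and F :: "'a \<Rightarrow> real"
  assumes F: "integrable M F"
    and g: "g \<in> borel_measurable M" "AE x in M. norm (g x) \<le> C"
    and g': "g' \<in> borel_measurable M" "AE x in M. norm (g' x) \<le> C'"
  shows "integrable M (\<lambda>x. F x * norm (g' x - g x))"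
proof (rule integrable_mult_AE_bounded[OF F, where C = "C' + C"])
  show "AE x in M. norm (norm (g' x - g x)) \<le> C' + C"
    using g(2) g'(2)
  proof eventually_elim
    case (elim x)
    then show ?case using norm_triangle_ineq4[of "g' x" "g x"] by simp
  qed
qed (use g g' in measurable)

text \<open>Induction on the generation of the topology: a subbasic set given by \<open>f\<close>
  has weight \<open>norm (f x)\<close>, and an intersection has the sum of the two weights. The
  radius \<open>d\<close> is chosen before \<open>C'\<close>, so no uniform bound on the
  approximants \<open>g'\<close> is needed.\<close>

lemma weak_star_neighbourhood_weight:
  fixes g :: "'a \<Rightarrow> complex"
  assumes V: "openin (weak_star_topology M) V" and gV: "ae_class M g \<in> V"
    and g: "g \<in> borel_measurable M" "AE x in M. norm (g x) \<le> C"
  shows "\<exists>F d. integrable M F \<and> (\<forall>x. 0 \<le> F x) \<and> (0::real) < d \<and>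
    (\<forall>g' C'. g' \<in> borel_measurable M \<longrightarrow> (AE x in M. norm (g' x) \<le> C') \<longrightarrow>
      (\<integral>x. F x * norm (g' x - g x) \<partial>M) < d \<longrightarrow> ae_class M g' \<in> V)"
    (is "?P V")
proof -
  have "generate_topology_on
      {{a \<in> L_infty M. L_pairing M a f \<in> U} | f U. integrable M f \<and> open U} V"
    using V by (simp add: weak_star_topology_def openin_topology_generated_by_iff)
  then show ?thesis using gV
  proof induction
    case Empty
    then show ?case by simp
  next
    case (Int V W)
    then have "?P V" "?P W" by blast+
    from \<open>?P V\<close> obtain F d where F: "integrable M F" "\<And>x. 0 \<le> F x" "(0::real) < d"
      "\<And>g' C'. g' \<in> borel_measurable M \<Longrightarrow> (AE x in M. norm (g' x) \<le> C') \<Longrightarrow>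
        (\<integral>x. F x * norm (g' x - g x) \<partial>M) < d \<Longrightarrow> ae_class M g' \<in> V"
      by blast
    from \<open>?P W\<close> obtain F' d' where F': "integrable M F'" "\<And>x. 0 \<le> F' x" "(0::real) < d'"
      "\<And>g' C'. g' \<in> borel_measurable M \<Longrightarrow> (AE x in M. norm (g' x) \<le> C') \<Longrightarrow>
        (\<integral>x. F' x * norm (g' x - g x) \<partial>M) < d' \<Longrightarrow> ae_class M g' \<in> W"
      by blast
    have "ae_class M g' \<in> V \<inter> W"
      if g': "g' \<in> borel_measurable M" "AE x in M. norm (g' x) \<le> C'"
        and less: "(\<integral>x. (F x + F' x) * norm (g' x - g x) \<partial>M) < min d d'" for g' C'
    proof -
      note i = integrable_weighted_diff[OF _ g g']
      \<comment> \<open>Both weights are nonnegative, so the integral against their sum dominates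
        each of the two integrals.\<close>
      have "(\<integral>x. F x * norm (g' x - g x) \<partial>M) \<le> (\<integral>x. (F x + F' x) * norm (g' x - g x) \<partial>M)"
        "(\<integral>x. F' x * norm (g' x - g x) \<partial>M) \<le> (\<integral>x. (F x + F' x) * norm (g' x - g x) \<partial>M)"
        using F F' by (auto intro!: integral_mono i mult_right_mono)
      then show ?thesis using less F(4)[OF g'] F'(4)[OF g'] by auto
    qed
    then show ?case
      using F F' by (intro exI[of _ "\<lambda>x. F x + F' x"] exI[of _ "min d d'"]) auto
  next
    case (UN K)
    then obtain k where k: "k \<in> K" "ae_class M g \<in> k" by blast
    then show ?case using UN(2)[OF k] by (meson UnionI)
  next
    case (Basis V)
    then obtain f U where V: "V = {a \<in> L_infty M. L_pairing M a f \<in> U}"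
      and f: "integrable M f" and U: "open U" by blast
    have fm: "f \<in> borel_measurable M" using f by simp
    have "(\<integral>x. g x * f x \<partial>M) \<in> U"
      using Basis(2) V L_pairing_ae_class[OF g(1) fm] by simp
    then obtain d where d: "d > 0" "ball (\<integral>x. g x * f x \<partial>M) d \<subseteq> U"
      using U by (meson openE)
    have "ae_class M g' \<in> V"
      if g': "g' \<in> borel_measurable M" "AE x in M. norm (g' x) \<le> C'"
        and less: "(\<integral>x. norm (f x) * norm (g' x - g x) \<partial>M) < d" for g' C'
    proof -
      have i: "integrable M (\<lambda>x. g x * f x)" "integrable M (\<lambda>x. g' x * f x)"
        using integrable_mult_AE_bounded[OF f g] integrable_mult_AE_bounded[OF f g']
        by (simp_all add: mult.commute)
      \<comment> \<open>The two pairings differ by at most the integral of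
        \<open>norm (f x) * norm (g' x - g x)\<close>, which is below the radius \<open>d\<close> of
        a ball inside \<open>U\<close>.\<close>
      have "norm ((\<integral>x. g' x * f x \<partial>M) - (\<integral>x. g x * f x \<partial>M))
          = norm (\<integral>x. g' x * f x - g x * f x \<partial>M)"
        using i by simp
      also have "\<dots> \<le> (\<integral>x. norm (g' x * f x - g x * f x) \<partial>M)"
        by (rule integral_norm_bound)
      also have "\<dots> = (\<integral>x. norm (f x) * norm (g' x - g x) \<partial>M)"
        by (simp add: norm_mult mult.commute[of "norm (f _)"] flip: left_diff_distrib)
      finally have "(\<integral>x. g' x * f x \<partial>M) \<in> U"
        using less d by (auto simp: dist_norm norm_minus_commute subset_iff)
      moreover have "ae_class M g' \<in> L_infty M"
        using g' unfolding L_infty_def by blast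
      ultimately show ?thesis using V L_pairing_ae_class[OF g'(1) fm] by simp
    qed
    then show ?case using f d
      by (intro exI[of _ "\<lambda>x. norm (f x)"] exI[of _ d]) auto
  qed
qed

section \<open>From density in the mean to weak-* density\<close>

theorem theorem2p2:
  fixes \<mu> :: "'a::metric_space measure"
    and A :: "('a \<Rightarrow> complex) set"
  assumes "locally_compact_space (euclidean :: 'a topology)"
    and "sigma_compact_space (euclidean :: 'a topology)"
    and "radon_measure \<mu>"
    and "\<And>U. open U \<Longrightarrow> U \<noteq> {} \<Longrightarrow> emeasure \<mu> U > 0"
    and "unital_selfadjoint_subalgebra A"
    and "separates_points A"
  shows "weak_star_topology \<mu> closure_of (ae_class \<mu> ` A) = L_infty \<mu>"
proof (intro equalityI subsetI)
  show "b \<in> L_infty \<mu>" if "b \<in> weak_star_topology \<mu> closure_of (ae_class \<mu> ` A)" for b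
    using that by (simp add: in_closure_of)
next
  have sets: "sets \<mu> = sets borel" using assms(3) by (simp add: radon_measure_def)
  fix b assume b: "b \<in> L_infty \<mu>"
  then obtain g C where bg: "b = ae_class \<mu> g"
    and g: "g \<in> borel_measurable \<mu>" "AE x in \<mu>. norm (g x) \<le> C"
    unfolding L_infty_def by auto
  have "\<exists>a\<in>A. ae_class \<mu> a \<in> V" if V: "b \<in> V" "openin (weak_star_topology \<mu>) V" for V
  proof -
    obtain F d where F: "integrable \<mu> F" "\<And>x. 0 \<le> F x" "(0::real) < d"
      "\<And>g' C'. g' \<in> borel_measurable \<mu> \<Longrightarrow> (AE x in \<mu>. norm (g' x) \<le> C') \<Longrightarrow>
        (\<integral>x. F x * norm (g' x - g x) \<partial>\<mu>) < d \<Longrightarrow> ae_class \<mu> g' \<in> V"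
      using weak_star_neighbourhood_weight[OF V(2) _ g] V(1) bg by blast
    \<comment> \<open>The weighted distance to \<open>g\<close> becomes the L1 distance for
      \<open>\<nu>\<close>. This measure is finite because \<open>F\<close> is integrable, even when
      \<open>\<mu>\<close> is infinite.\<close>
    define \<nu> where "\<nu> = density \<mu> F"
    have \<nu>: "finite_measure \<nu>" "sets \<nu> = sets borel"
      using F(1,2) sets
      by (auto simp: \<nu>_def emeasure_density nn_integral_eq_integral intro!: finite_measureI)
    \<comment> \<open>Integrability for \<open>\<nu>\<close> means integrability of
      \<open>F x *\<^sub>R g x\<close> for \<open>\<mu>\<close>, which holds since \<open>g\<close>
      is essentially bounded.\<close>
    have "integrable \<nu> g"
      using integrable_mult_AE_bounded[OF F(1), of "\<lambda>x. norm (g x)"] g F(1,2)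
      by (auto simp: \<nu>_def integrable_density intro!: integrable_norm_cancel[where f = "\<lambda>x. F x *\<^sub>R g x"])
    then have "g \<in> L1_closure \<nu> A"
      using L1_closure_eq_integrable[OF \<nu> assms(2,5,6)] by simp
    then obtain a where a: "a \<in> A" "(\<integral>x. norm (a x - g x) \<partial>\<nu>) < d"
      using F(3) unfolding L1_closure_def by blast
    obtain C' where a': "a \<in> borel_measurable \<mu>" "\<And>x. norm (a x) \<le> C'"
      using subalgebra_measurable[OF assms(5) sets a(1)] by blast
    have "(\<integral>x. norm (a x - g x) \<partial>\<nu>) = (\<integral>x. F x * norm (a x - g x) \<partial>\<mu>)"
      unfolding \<nu>_def using F(1,2) a'(1) g(1) by (intro integral_real_density) auto
    then have "ae_class \<mu> a \<in> V"
      using F(4)[OF a'(1), of C'] a a'(2) by simp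
    then show ?thesis using a(1) by blast
  qed
  then show "b \<in> weak_star_topology \<mu> closure_of (ae_class \<mu> ` A)"
    using b by (auto simp: in_closure_of)
qed

end
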